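(* Let $X$ be an interval space and $a,b\in X$. If the binary relation $\langle[a,b],\cdot,\cdot\rangle$ on $X$ is transitive, then for every $c\in X$, $[\{a\},[b,c]]\subseteq[[a,b],\{c\}]$.
   Context: An interval space is a set $X$ with a ternary relation $\langle\cdot,\cdot,\cdot\rangle$ such that: $\langle x,x,a\rangle$ and $\langle a,x,x\rangle$ for all $a,x\in X$; $\langle x,a,z\rangle\Rightarrow\langle z,a,x\rangle$; and $\langle x,y,x\rangle$ implies $y=x$. For $A\subseteq X$ and $b,c\in X$, $\langle A,b,c\rangle$ means there is $a\in A$ with $\langle a,b,c\rangle$. For $a,c\in X$, $[a,c]=\{x\in X:\langle a,x,c\rangle\}$; for $A,C\subseteq X$, $[A,C]=\{x\in X: \exists a\in A,\,c\in C,\ \langle a,x,c\rangle\}$. *)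

theory Defs
  imports Main
begin

text \<open>The ternary relation is a predicate on the ambient type; only its restriction to the
  carrier \<open>X\<close> is ever used.\<close>

locale interval_space =
  fixes X :: "'a set" and R :: "'a \<Rightarrow> 'a \<Rightarrow> 'a \<Rightarrow> bool"
  assumes left_refl: "x \<in> X \<Longrightarrow> a \<in> X \<Longrightarrow> R x x a"
    and right_refl: "x \<in> X \<Longrightarrow> a \<in> X \<Longrightarrow> R a x x"
    and symmetric: "x \<in> X \<Longrightarrow> a \<in> X \<Longrightarrow> z \<in> X \<Longrightarrow> R x a z \<Longrightarrow> R z a x"
    and degenerate: "x \<in> X \<Longrightarrow> y \<in> X \<Longrightarrow> R x y x \<Longrightarrow> y = x"

definition set_rel :: "('a \<Rightarrow> 'a \<Rightarrow> 'a \<Rightarrow> bool) \<Rightarrow> 'a set \<Rightarrow> 'a \<Rightarrow> 'a \<Rightarrow> bool" where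
  "set_rel R A b c \<longleftrightarrow> (\<exists>a\<in>A. R a b c)"

definition interval :: "'a set \<Rightarrow> ('a \<Rightarrow> 'a \<Rightarrow> 'a \<Rightarrow> bool) \<Rightarrow> 'a \<Rightarrow> 'a \<Rightarrow> 'a set" where
  "interval X R a c = {x \<in> X. R a x c}"

definition set_interval :: "'a set \<Rightarrow> ('a \<Rightarrow> 'a \<Rightarrow> 'a \<Rightarrow> bool) \<Rightarrow> 'a set \<Rightarrow> 'a set \<Rightarrow> 'a set" where
  "set_interval X R A C = {x \<in> X. \<exists>a\<in>A. \<exists>c\<in>C. R a x c}"

end

theory Submission
  imports Defs
begin

text \<open>The interval from \<open>a\<close> to \<open>b\<close> contains both endpoints, so
  \<open>R a x y\<close> and \<open>R b y c\<close> are two instances of the single relation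
  \<open>set_rel R (interval X R a b)\<close>, chained through \<open>y\<close>. Transitivity
  removes \<open>y\<close>, and relating \<open>x\<close> to \<open>c\<close> by this relation is
  exactly membership of \<open>x\<close> in the right-hand set.\<close>

theorem proposition2p2:
  fixes X :: "'a set" and R :: "'a \<Rightarrow> 'a \<Rightarrow> 'a \<Rightarrow> bool" and a b :: 'a
  assumes "interval_space X R"
    and "a \<in> X" and "b \<in> X"
    and "transp_on X (set_rel R (interval X R a b))"
  shows "\<forall>c\<in>X. set_interval X R {a} (interval X R b c)
                 \<subseteq> set_interval X R (interval X R a b) {c}"
proof (intro ballI subsetI)
  fix c x
  assume c: "c \<in> X" and "x \<in> set_interval X R {a} (interval X R b c)"
  then obtain y where x: "x \<in> X" and y: "y \<in> X" and "R a x y" and "R b y c"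
    by (auto simp: set_interval_def interval_def)
  interpret interval_space X R by fact
  have "a \<in> interval X R a b" "b \<in> interval X R a b"
    using \<open>a \<in> X\<close> \<open>b \<in> X\<close> by (simp_all add: interval_def left_refl right_refl)
  with \<open>R a x y\<close> \<open>R b y c\<close>
  \<comment> \<open>The witness in the interval is \<open>a\<close> for the first relation and
    \<open>b\<close> for the second.\<close>
  have "set_rel R (interval X R a b) x y" "set_rel R (interval X R a b) y c"
    by (auto simp: set_rel_def)
  \<comment> \<open>Transitivity is only assumed on \<open>X\<close>, hence the membership facts for
    \<open>x\<close>, \<open>y\<close> and \<open>c\<close>.\<close>
  with assms(4) x y c have "set_rel R (interval X R a b) x c"
    by (blast dest: transp_onD)
  with x show "x \<in> set_interval X R (interval X R a b) {c}"
    by (simp add: set_rel_def set_interval_def)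
qed

end
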